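(* For any $k\ge 3$, there is a symmetric weighted competition game with $k$ firms that does not have a PSPE at all.
   Context: Competition game: $N$ is a finite set of workers, $K$ a finite set of $k\ge 2$ firms, and each firm $i\in K$ has a nondecreasing value function $v_i:2^N\to\mathbb R_+$ with $v_i(\emptyset)=0$. In step 1 all firms simultaneously choose payment policies $\mathbf x_i=(x_{ij})_{j\in N}\in\mathbb R^N$ (payments may be negative). In step 2 each worker chooses a firm or stays idle. An outcome is a pair $(P,\mathbf X)$ where $\mathbf X=(x_{ij})$ and $P=(S_0,(S_i)_{i\in K})$ is a partition of $N$ ($S_0$ = idle workers; parts may be empty). Put $x_{0j}=0$. A worker $j\in S_i$ receives $\hat x_j=x_{ij}$; firm $i$ has profit $r_i(P,\mathbf X)=v_i(S_i)-\sum_{j\in S_i}x_{ij}$. The game is symmetric if all $v_i$ are equal. PSPE: let $\mathcal P(\mathbf X)$ be the set of partitions such that every worker $j\in S_i$ ($i\in K\cup\{0\}$) satisfies $x_{ij}=\max_{i'\in K\cup\{0\}}x_{i'j}$. A tie-breaking rule is a map $\mathbf X\mapsto P(\mathbf X)\in\mathcal P(\mathbf X)$. An outcome $(P,\mathbf X)$ is a pure subgame perfect equilibrium (PSPE) if for some tie-breaking rule: (a) $P=P(\mathbf X)$; and (b) for every $i\in K$ and every policy $\mathbf x_i'$, $r_i(P',\mathbf X')\le r_i(P,\mathbf X)$, where $\mathbf X'=(\mathbf x_{-i},\mathbf x_i')$ and $P'=P(\mathbf X')$. Weighted game: each worker $j$ has a positive integer weight $w_j$, and $v_i(S)=v_i\big(\sum_{j\in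 S}w_j\big)$ for a nondecreasing function $v_i:\mathbb N\to\mathbb R_+$ with $v_i(0)=0$ whose marginals $v_i(t+1)-v_i(t)$ are nonincreasing in $t$. *)

theory Defs
  imports Complex_Main "HOL-Library.FuncSet" "HOL-Library.Disjoint_Sets"
begin

definition competition_game ::
  "'w set \<Rightarrow> 'f set \<Rightarrow> ('f \<Rightarrow> 'w set \<Rightarrow> real) \<Rightarrow> bool" where
  "competition_game N K v \<longleftrightarrow>
     finite N \<and> finite K \<and> 2 \<le> card K \<and>
     (\<forall>i\<in>K. v i {} = 0 \<and> (\<forall>S\<in>Pow N. 0 \<le> v i S) \<and> mono_on (Pow N) (v i))"

definition symmetric_game ::
  "'w set \<Rightarrow> 'f set \<Rightarrow> ('f \<Rightarrow> 'w set \<Rightarrow> real) \<Rightarrow> bool" where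
  "symmetric_game N K v \<longleftrightarrow> (\<forall>i\<in>K. \<forall>i'\<in>K. \<forall>S\<in>Pow N. v i S = v i' S)"

definition weighted_game ::
  "'w set \<Rightarrow> 'f set \<Rightarrow> ('f \<Rightarrow> 'w set \<Rightarrow> real) \<Rightarrow> bool" where
  "weighted_game N K v \<longleftrightarrow>
     (\<exists>(w :: 'w \<Rightarrow> nat) (u :: 'f \<Rightarrow> nat \<Rightarrow> real).
        (\<forall>j\<in>N. 0 < w j) \<and>
        (\<forall>i\<in>K. u i 0 = 0 \<and> (\<forall>t. 0 \<le> u i t) \<and> mono (u i) \<and>
               antimono (\<lambda>t. u i (t + 1) - u i t)) \<and>
        (\<forall>i\<in>K. \<forall>S\<in>Pow N. v i S = u i (\<Sum>j\<in>S. w j)))"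

text \<open>
  Payment policies and profiles are extensional, so they correspond exactly to the
  vectors and matrices indexed by \<open>N\<close> and \<open>K \<times> N\<close>; in particular, a tie-breaking rule
  cannot depend on values outside these index sets.
\<close>

definition policies :: "'w set \<Rightarrow> ('w \<Rightarrow> real) set" where
  "policies N = N \<rightarrow>\<^sub>E UNIV"

definition profiles :: "'w set \<Rightarrow> 'f set \<Rightarrow> ('f \<Rightarrow> 'w \<Rightarrow> real) set" where
  "profiles N K = K \<rightarrow>\<^sub>E policies N"

text \<open>
  A worker's options: \<^term>\<open>Some i\<close> is firm \<open>i\<close>, and \<^term>\<open>None\<close> (index 0 in the usual
  notation) is staying idle, which pays 0.
\<close>

definition choices :: "'f set \<Rightarrow> 'f option set" where
  "choices K = insert None (Some ` K)"

definition payment :: "('f \<Rightarrow> 'w \<Rightarrow> real) \<Rightarrow> 'f option \<Rightarrow> 'w \<Rightarrow> real" where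
  "payment X c j = (case c of None \<Rightarrow> 0 | Some i \<Rightarrow> X i j)"

definition partitions :: "'w set \<Rightarrow> 'f set \<Rightarrow> ('f option \<Rightarrow> 'w set) set" where
  "partitions N K =
     {P \<in> choices K \<rightarrow>\<^sub>E Pow N. disjoint_family_on P (choices K) \<and> (\<Union>c\<in>choices K. P c) = N}"

definition profit ::
  "('f \<Rightarrow> 'w set \<Rightarrow> real) \<Rightarrow> 'f \<Rightarrow> ('f option \<Rightarrow> 'w set) \<Rightarrow> ('f \<Rightarrow> 'w \<Rightarrow> real) \<Rightarrow> real" where
  "profit v i P X = v i (P (Some i)) - (\<Sum>j\<in>P (Some i). X i j)"

definition optimal_partitions ::
  "'w set \<Rightarrow> 'f set \<Rightarrow> ('f \<Rightarrow> 'w \<Rightarrow> real) \<Rightarrow> ('f option \<Rightarrow> 'w set) set" where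
  "optimal_partitions N K X =
     {P \<in> partitions N K.
        \<forall>c\<in>choices K. \<forall>j\<in>P c. payment X c j = Max ((\<lambda>c'. payment X c' j) ` choices K)}"

definition tie_breaking_rule ::
  "'w set \<Rightarrow> 'f set \<Rightarrow> (('f \<Rightarrow> 'w \<Rightarrow> real) \<Rightarrow> 'f option \<Rightarrow> 'w set) \<Rightarrow> bool" where
  "tie_breaking_rule N K T \<longleftrightarrow> (\<forall>X\<in>profiles N K. T X \<in> optimal_partitions N K X)"

definition is_PSPE ::
  "'w set \<Rightarrow> 'f set \<Rightarrow> ('f \<Rightarrow> 'w set \<Rightarrow> real) \<Rightarrow>
   ('f option \<Rightarrow> 'w set) \<Rightarrow> ('f \<Rightarrow> 'w \<Rightarrow> real) \<Rightarrow> bool" where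
  "is_PSPE N K v P X \<longleftrightarrow>
     P \<in> partitions N K \<and> X \<in> profiles N K \<and>
     (\<exists>T. tie_breaking_rule N K T \<and> P = T X \<and>
        (\<forall>i\<in>K. \<forall>x'\<in>policies N.
           profit v i (T (X(i := x'))) (X(i := x')) \<le> profit v i P X))"

end

theory Submission
  imports Defs
begin

text \<open>
  Raising the offer to an arbitrary set of workers slightly above the going wages lets a firm
  hire exactly that set, so in a PSPE the maximal payments are Walrasian prices: every firm
  hires a profit-maximising bundle and idle workers cost nothing. As in the first welfare
  theorem, the equilibrium welfare is then at least that of every fractional allocation.

  Take \<open>v(S) = min 15 (w(S))\<close> with the weights 14, 7, 6, 5, 4, 4, 3, 2 and \<open>k - 3\<close> further
  weights 15, which sum to \<open>15 k\<close>. The bundles 14, 14+2, 7+5+3, 7+4+4, 6+4+3+2, 6+5+4, each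
  used with intensity 1/2, give a fractional welfare of \<open>15 k - 1/2\<close>. Integrality
  forces welfare \<open>15 k\<close>, hence every load is exactly 15, although no worker of weight 1 is
  available to complete the worker of weight 14.
\<close>

section \<open>Equilibrium wages as Walrasian prices, and the fractional welfare bound\<close>

lemma sum_partitions:
  fixes f :: "'w \<Rightarrow> 'a::comm_monoid_add"
  assumes "finite N" "finite K" "P \<in> partitions N K"
  shows "sum f N = sum f (P None) + (\<Sum>i\<in>K. sum f (P (Some i)))"
proof -
  have P: "\<And>c. c \<in> choices K \<Longrightarrow> P c \<subseteq> N" "disjoint_family_on P (choices K)"
    and U: "(\<Union>c\<in>choices K. P c) = N"
    using assms(3) by (auto simp: partitions_def)
  have "sum f N = (\<Sum>c\<in>choices K. sum f (P c))"
    unfolding U[symmetric]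
  proof (rule sum.UNION_disjoint)
    show "finite (choices K)" using assms(2) by (simp add: choices_def)
    show "\<forall>c\<in>choices K. finite (P c)" using P(1) assms(1) finite_subset by blast
    show "\<forall>c\<in>choices K. \<forall>c'\<in>choices K. c \<noteq> c' \<longrightarrow> P c \<inter> P c' = {}"
      using P(2) by (auto simp: disjoint_family_on_def)
  qed
  also have "\<dots> = sum f (P None) + (\<Sum>c\<in>Some ` K. sum f (P c))"
    unfolding choices_def using assms(2) by (subst sum.insert) auto
  also have "(\<Sum>c\<in>Some ` K. sum f (P c)) = (\<Sum>i\<in>K. sum f (P (Some i)))"
    by (simp add: sum.reindex)
  finally show ?thesis .
qed

definition wage :: "'f set \<Rightarrow> ('f \<Rightarrow> 'w \<Rightarrow> real) \<Rightarrow> 'w \<Rightarrow> real" where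
  "wage K X j = Max ((\<lambda>c. payment X c j) ` choices K)"

lemma payment_le_wage:
  assumes "finite K" "c \<in> choices K"
  shows "payment X c j \<le> wage K X j"
  unfolding wage_def using assms by (intro Max_ge) (auto simp: choices_def)

lemma wage_nonneg: "finite K \<Longrightarrow> 0 \<le> wage K X j"
  using payment_le_wage[of K None X j] by (simp add: choices_def payment_def)

lemma optimal_partitions_payment:
  assumes "P \<in> optimal_partitions N K X" "c \<in> choices K" "j \<in> P c"
  shows "payment X c j = wage K X j"
  using assms unfolding optimal_partitions_def wage_def by blast

text \<open>On \<open>S\<close> the new offer strictly beats every old option, and off
  \<open>S\<close> a negative offer loses to staying idle. Neither case leaves a tie involving firm
  \<open>i\<close>, so the conclusion holds for every optimal partition and thus for any
  tie-breaking rule.\<close>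

lemma overbidding_hires_exactly:
  assumes fin: "finite K" and i: "i \<in> K" and S: "S \<subseteq> N"
    and high: "\<And>j. j \<in> S \<Longrightarrow> wage K X j < x j"
    and low: "\<And>j. j \<in> N - S \<Longrightarrow> x j < 0"
    and P: "P \<in> optimal_partitions N K (X(i := x))"
  shows "P (Some i) = S"
proof -
  let ?Y = "X(i := x)"
  have part: "\<And>c. c \<in> choices K \<Longrightarrow> P c \<subseteq> N" "(\<Union>c\<in>choices K. P c) = N"
    using P by (auto simp: optimal_partitions_def partitions_def)
  have ic: "Some i \<in> choices K" using i by (simp add: choices_def)
  show ?thesis
  proof (intro equalityI subsetI)
    fix j assume j: "j \<in> P (Some i)"
    have "0 \<le> x j"
      using optimal_partitions_payment[OF P ic j] wage_nonneg[OF fin, of ?Y j]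
      by (simp add: payment_def)
    moreover have "j \<in> N" using part(1)[OF ic] j by blast
    ultimately show "j \<in> S" using low[of j] by force
  next
    fix j assume j: "j \<in> S"
    then obtain c where c: "c \<in> choices K" "j \<in> P c" using part(2) S by blast
    have "x j \<le> payment ?Y c j"
      using payment_le_wage[OF fin ic, of ?Y j] optimal_partitions_payment[OF P c]
      by (simp add: payment_def)
    moreover have "payment ?Y c j = payment X c j" if "c \<noteq> Some i"
      using that by (auto simp: payment_def split: option.splits)
    moreover have "payment X c j < x j"
      using payment_le_wage[OF fin c(1), of X j] high[OF j] by linarith
    ultimately have "c = Some i" by fastforce
    then show "j \<in> P (Some i)" using c(2) by simp
  qed
qed

text \<open>Firm \<open>i\<close> can buy \<open>S\<close> at the going wages plus an arbitrarily
  small surcharge, which is paid only to defeat the tie-breaking rule. Unprofitability of all these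
  deviations gives the bound in the limit.\<close>

lemma PSPE_walrasian:
  assumes finN: "finite N" and fin: "finite K" and eq: "is_PSPE N K v P X"
    and i: "i \<in> K" and S: "S \<subseteq> N"
  shows "v i S - sum (wage K X) S \<le> profit v i P X"
proof (rule field_le_epsilon)
  fix e :: real assume e: "0 < e"
  obtain T where T: "tie_breaking_rule N K T"
    and dev: "\<And>x. x \<in> policies N \<Longrightarrow>
      profit v i (T (X(i := x))) (X(i := x)) \<le> profit v i P X"
    and X: "X \<in> profiles N K"
    using eq i unfolding is_PSPE_def by blast
  \<comment> \<open>The surcharge per worker: it adds up to at most \<open>e\<close> over
    \<open>S\<close>, and the \<open>+ 1\<close> covers empty \<open>S\<close>.\<close>
  define d where "d = e / (card S + 1)"
  have d: "0 < d" "card S * d \<le> e" using e by (simp_all add: d_def field_simps)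
  define x where "x = (\<lambda>j\<in>N. if j \<in> S then wage K X j + d else -1)"
  have x: "x \<in> policies N" by (auto simp: x_def policies_def)
  then have "X(i := x) \<in> profiles N K"
    using X i by (auto simp: profiles_def PiE_iff extensional_def)
  then have "T (X(i := x)) \<in> optimal_partitions N K (X(i := x))"
    using T by (simp add: tie_breaking_rule_def)
  then have "T (X(i := x)) (Some i) = S"
    by (rule overbidding_hires_exactly[OF fin i S, rotated 2])
       (use d S in \<open>auto simp: x_def\<close>)
  moreover have "sum x S = (\<Sum>j\<in>S. wage K X j + d)"
    using S by (intro sum.cong) (auto simp: x_def)
  ultimately have "v i S - (sum (wage K X) S + card S * d) \<le> profit v i P X"
    using dev[OF x] by (simp add: profit_def sum.distrib)
  then show "v i S - sum (wage K X) S \<le> profit v i P X + e" using d by linarith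
qed

text \<open>Hired workers are paid exactly their wage and idle ones have wage 0, so the firms
  together pay out the wages of all of \<open>N\<close>.\<close>

lemma PSPE_sum_profit:
  assumes finN: "finite N" and fin: "finite K" and eq: "is_PSPE N K v P X"
  shows "(\<Sum>i\<in>K. profit v i P X) = (\<Sum>i\<in>K. v i (P (Some i))) - sum (wage K X) N"
proof -
  have P: "P \<in> partitions N K" "P \<in> optimal_partitions N K X"
    using eq unfolding is_PSPE_def tie_breaking_rule_def by auto
  have "wage K X j = 0" if "j \<in> P None" for j
    using optimal_partitions_payment[OF P(2) _ that]
    by (simp add: choices_def payment_def)
  then have idle: "sum (wage K X) (P None) = 0" by simp
  have hired: "sum (X i) (P (Some i)) = sum (wage K X) (P (Some i))" if "i \<in> K" for i
    using optimal_partitions_payment[OF P(2), of "Some i"] that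
    by (intro sum.cong) (auto simp: choices_def payment_def)
  show ?thesis
    using sum_partitions[OF finN fin P(1), of "wage K X"] idle hired
    by (simp add: profit_def sum_subtractf)
qed

text \<open>\<open>A\<close> encodes a fractional allocation in which every bundle
  \<open>A m i\<close> has intensity \<open>1 / card M\<close>; \<open>cover\<close> says that no
  worker is used more than once in total. Summing the Walrasian inequalities over \<open>m\<close>
  and \<open>i\<close> makes the wages cancel.\<close>

lemma PSPE_welfare:
  fixes v :: "'f \<Rightarrow> 'w set \<Rightarrow> real" and A :: "'m \<Rightarrow> 'f \<Rightarrow> 'w set"
  assumes finN: "finite N" and fin: "finite K" and eq: "is_PSPE N K v P X"
    and A: "\<And>m i. m \<in> M \<Longrightarrow> i \<in> K \<Longrightarrow> A m i \<subseteq> N"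
    and cover: "\<And>j. j \<in> N \<Longrightarrow> (\<Sum>m\<in>M. \<Sum>i\<in>K. of_bool (j \<in> A m i)) \<le> real (card M)"
  shows "(\<Sum>m\<in>M. \<Sum>i\<in>K. v i (A m i)) \<le> card M * (\<Sum>i\<in>K. v i (P (Some i)))"
proof -
  let ?p = "wage K X"
  have "(\<Sum>m\<in>M. \<Sum>i\<in>K. sum ?p (A m i))
      = (\<Sum>m\<in>M. \<Sum>i\<in>K. \<Sum>j\<in>N. ?p j * of_bool (j \<in> A m i))"
  proof (rule sum.cong[OF refl], rule sum.cong[OF refl])
    fix m i assume "m \<in> M" "i \<in> K"
    then have "A m i \<subseteq> N" by (rule A)
    then show "sum ?p (A m i) = (\<Sum>j\<in>N. ?p j * of_bool (j \<in> A m i))"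
      using finN by (simp add: Int_absorb1 flip: sum.inter_restrict if_distrib)
  qed
  also have "\<dots> = (\<Sum>j\<in>N. ?p j * (\<Sum>m\<in>M. \<Sum>i\<in>K. of_bool (j \<in> A m i)))"
    by (simp add: sum_distrib_left sum.swap[of _ N])
  \<comment> \<open>Wages are nonnegative thanks to the idle option, so covering a worker too rarely
    does no harm.\<close>
  also have "\<dots> \<le> (\<Sum>j\<in>N. ?p j * card M)"
    using wage_nonneg[OF fin] cover by (intro sum_mono mult_left_mono)
  finally have cost: "(\<Sum>m\<in>M. \<Sum>i\<in>K. sum ?p (A m i)) \<le> card M * sum ?p N"
    by (simp add: mult.commute flip: sum_distrib_left)
  have "(\<Sum>m\<in>M. \<Sum>i\<in>K. v i (A m i) - sum ?p (A m i)) \<le> (\<Sum>m\<in>M. \<Sum>i\<in>K. profit v i P X)"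
    using PSPE_walrasian[OF finN fin eq _ A] by (intro sum_mono)
  then show ?thesis
    using cost by (simp add: PSPE_sum_profit[OF finN fin eq] sum_subtractf right_diff_distrib)
qed

section \<open>The game with loads capped at 15\<close>

definition weight :: "nat \<Rightarrow> nat" where
  "weight j = (if j < 8 then [14, 7, 6, 5, 4, 4, 3, 2] ! j else 15)"

text \<open>The flag \<open>m\<close> selects one of two layers. Neither is an allocation by itself:
  worker 6 occurs twice for \<open>True\<close> and worker 5 twice for \<open>False\<close>. Only
  their average is feasible.\<close>

definition half_bundle :: "bool \<Rightarrow> nat \<Rightarrow> nat set" where
  "half_bundle m i =
     (if 3 \<le> i then {i + 5}
      else (if m then [{0}, {1, 3, 6}, {2, 4, 6, 7}] else [{0, 7}, {1, 4, 5}, {2, 3, 5}]) ! i)"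

lemma weight_ge_2: "2 \<le> weight j"
proof (cases "j < 8")
  case True
  then have "j \<in> {0, 1, 2, 3, 4, 5, 6, 7}" by auto
  then show ?thesis by (auto simp: weight_def)
qed (simp add: weight_def)

lemma sum_split_3:
  assumes "(3::nat) \<le> k"
  shows "(\<Sum>i<k. f i) = f 0 + f 1 + f 2 + (\<Sum>i=3..<k. f i)"
proof -
  have "sum f {..<k} = sum f {..<3} + sum f {3..<k}"
    using assms sum.atLeastLessThan_concat[of 0 3 k f] by (simp add: lessThan_atLeast0)
  then show ?thesis by (simp add: numeral_eq_Suc)
qed

lemma sum_weight:
  assumes "3 \<le> k"
  shows "sum weight {..<k + 5} = 15 * k"
proof -
  have "sum weight {..<k + 5} = sum weight {..<8} + sum weight {8..<k + 5}"
    using assms sum.atLeastLessThan_concat[of 0 8 "k + 5" weight] by (simp add: lessThan_atLeast0)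
  also have "sum weight {..<8} = 45" by (simp add: weight_def numeral_eq_Suc)
  also have "sum weight {8..<k + 5} = (\<Sum>j=8..<k + 5. 15)"
    by (intro sum.cong) (auto simp: weight_def)
  finally show ?thesis using assms by simp
qed

lemma half_bundle_subset: "3 \<le> k \<Longrightarrow> i < k \<Longrightarrow> half_bundle m i \<subseteq> {..<k + 5}"
  by (cases "i < 3") (auto simp: half_bundle_def less_Suc_eq numeral_3_eq_3)

lemma half_bundle_cover:
  assumes "3 \<le> k"
  shows "(\<Sum>m\<in>UNIV. \<Sum>i<k. of_bool (j \<in> half_bundle m i)) \<le> (2::real)"
proof (cases "j < 8")
  case True
  then have "(\<Sum>i=3..<k. of_bool (j \<in> half_bundle m i)) = (0::real)" for m
    by (intro sum.neutral) (auto simp: half_bundle_def)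
  then show ?thesis
    using assms by (simp add: sum_split_3 UNIV_bool half_bundle_def del: sum_of_bool_eq)
next
  case False
  \<comment> \<open>A heavy worker can only be in the singleton bundle of firm \<open>j - 5\<close>;
    the subtraction does not truncate as \<open>8 \<le> j\<close>.\<close>
  have "(\<Sum>i=3..<k. of_bool (j \<in> half_bundle m i)) = (\<Sum>i=3..<k. if j - 5 = i then 1 else 0 :: real)" for m
    using False by (intro sum.cong) (auto simp: half_bundle_def)
  then have "(\<Sum>i=3..<k. of_bool (j \<in> half_bundle m i)) \<le> (1::real)" for m
    by (simp add: sum.delta')
  from this[of True] this[of False] show ?thesis
    using assms False by (simp add: sum_split_3 UNIV_bool half_bundle_def del: sum_of_bool_eq)
qed

text \<open>The bundle \<open>{0}\<close> falls short of the cap by 1, \<open>{0, 7}\<close> has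
  load 16 and is cut to 15, and all other loads are exactly 15.\<close>

lemma half_bundle_value:
  assumes "3 \<le> k"
  shows "(\<Sum>m\<in>UNIV. \<Sum>i<k. real (min 15 (sum weight (half_bundle m i)))) = 30 * real k - 1"
proof -
  have "(\<Sum>i=3..<k. real (min 15 (sum weight (half_bundle m i)))) = (\<Sum>i=3..<k. 15)" for m
    by (intro sum.cong) (auto simp: half_bundle_def weight_def)
  then show ?thesis
    using assms by (simp add: sum_split_3 UNIV_bool half_bundle_def weight_def)
qed

text \<open>The termwise bounds \<open>min c (f i) \<le> c\<close> and
  \<open>min c (f i) \<le> f i\<close> are both tight after summation, hence tight in each
  term.\<close>

lemma sum_min_eqD:
  fixes f :: "'a \<Rightarrow> nat"
  assumes "finite K" "c * card K \<le> (\<Sum>i\<in>K. min c (f i))" "sum f K \<le> c * card K" "i \<in> K"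
  shows "f i = c"
proof -
  have le: "(\<Sum>i\<in>K. min c (f i)) \<le> sum f K" by (intro sum_mono) simp
  have "(\<Sum>i\<in>K. min c (f i)) \<le> (\<Sum>i\<in>K. c)" by (intro sum_mono) simp
  then have "(\<Sum>i\<in>K. min c (f i)) = (\<Sum>i\<in>K. c)" "(\<Sum>i\<in>K. min c (f i)) = sum f K"
    using assms(2,3) le by (simp_all add: mult.commute)
  from sum_mono_inv[OF this(1) _ assms(4,1)] sum_mono_inv[OF this(2) _ assms(4,1)]
  show ?thesis by simp
qed

text \<open>The total weight is \<open>15 * k\<close>, so reaching this value leaves no slack:
  nobody is idle and every load is 15. The colleagues of worker 0 would then have total weight 1,
  but each weighs at least 2.\<close>

lemma no_perfect_load:
  assumes "3 \<le> k" "P \<in> partitions {..<k + 5} {..<k}"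
  shows "\<not> 15 * k \<le> (\<Sum>i<k. min 15 (sum weight (P (Some i))))"
proof
  assume "15 * k \<le> (\<Sum>i<k. min 15 (sum weight (P (Some i))))"
  moreover have total:
    "15 * k = sum weight (P None) + (\<Sum>i<k. sum weight (P (Some i)))"
    using sum_partitions[OF _ _ assms(2), of weight] sum_weight[OF assms(1)] by simp
  ultimately have load: "sum weight (P (Some i)) = 15" if "i < k" for i
    using sum_min_eqD[of "{..<k}" 15 "\<lambda>i. sum weight (P (Some i))" i] that by simp
  have fin: "finite (P c)" if "c \<in> choices {..<k}" for c
    using assms(2) that by (auto simp: partitions_def intro!: finite_subset[of "P c" "{..<k + 5}"])
  have "sum weight (P None) = 0" using total load by simp
  moreover have "weight j \<noteq> 0" for j using weight_ge_2[of j] by simp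
  ultimately have "P None = {}"
    using fin[of None] by (auto simp: choices_def sum_eq_0_iff)
  moreover have "0 \<in> (\<Union>c\<in>choices {..<k}. P c)"
    using assms(2) by (auto simp: partitions_def)
  ultimately obtain i where i: "i < k" "0 \<in> P (Some i)"
    by (auto simp: choices_def)
  have finP: "finite (P (Some i))" using fin i(1) by (simp add: choices_def)
  have "sum weight (P (Some i) - {0}) = 1"
    using load[OF i(1)] sum.remove[OF finP i(2), of weight] by (simp add: weight_def)
  then obtain j where "j \<in> P (Some i) - {0}"
    by (metis all_not_in_conv sum.empty zero_neq_one)
  then have "weight j \<le> 1"
    using member_le_sum[of j "P (Some i) - {0}" weight] finP
      \<open>sum weight (P (Some i) - {0}) = 1\<close> by simp
  then show False using weight_ge_2[of j] by simp
qed

theorem proposition4p3: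
  fixes k :: nat
  assumes "3 \<le> k"
  shows "\<exists>(N :: nat set) (K :: nat set) (v :: nat \<Rightarrow> nat set \<Rightarrow> real).
           card K = k \<and> competition_game N K v \<and> symmetric_game N K v \<and> weighted_game N K v \<and>
           \<not> (\<exists>P X. is_PSPE N K v P X)"
proof -
  define N K where "N = {..<k + 5}" and "K = {..<k}"
  define v :: "nat \<Rightarrow> nat set \<Rightarrow> real" where "v = (\<lambda>i S. real (min 15 (sum weight S)))"
  have "mono_on (Pow N) (v i)" for i
  proof (rule mono_onI)
    fix S S' assume "S' \<in> Pow N" "S \<subseteq> S'"
    then have "sum weight S \<le> sum weight S'"
      by (intro sum_mono2) (auto simp: N_def intro: finite_subset)
    then show "v i S \<le> v i S'" by (simp add: v_def min.coboundedI2)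
  qed
  then have "competition_game N K v"
    using assms by (auto simp: competition_game_def N_def K_def v_def)
  moreover have "symmetric_game N K v"
    by (simp add: symmetric_game_def v_def)
  moreover have "weighted_game N K v"
    unfolding weighted_game_def
  proof (intro exI conjI ballI)
    let ?u = "\<lambda>(i::nat) t. real (min 15 t)"
    show "0 < weight j" for j using weight_ge_2[of j] by simp
    show "?u i 0 = 0" "mono (?u i)" "\<forall>t. 0 \<le> ?u i t" for i by (auto intro!: monoI)
    show "antimono (\<lambda>t. ?u i (t + 1) - ?u i t)" for i by (intro antimonoI) (simp add: min_def)
    show "v i S = ?u i (\<Sum>j\<in>S. weight j)" for i S by (simp add: v_def)
  qed
  moreover have False if eq: "is_PSPE N K v P X" for P X
  proof -
    have P: "P \<in> partitions N K" using eq by (simp add: is_PSPE_def)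
    have "(\<Sum>m\<in>UNIV. \<Sum>i\<in>K. v i (half_bundle m i)) \<le> card (UNIV :: bool set) * (\<Sum>i\<in>K. v i (P (Some i)))"
      by (rule PSPE_welfare[OF _ _ eq])
         (use assms half_bundle_subset half_bundle_cover in \<open>auto simp: N_def K_def\<close>)
    then have "30 * real k - 1 \<le> 2 * real (\<Sum>i<k. min 15 (sum weight (P (Some i))))"
      using half_bundle_value[OF assms] by (simp add: v_def K_def)
    \<comment> \<open>The right-hand sum is a natural number, so the bound \<open>15 k - 1/2\<close>
      rounds up.\<close>
    then have "15 * k \<le> (\<Sum>i<k. min 15 (sum weight (P (Some i))))"
      by linarith
    then show False using no_perfect_load[OF assms] P by (simp add: N_def K_def)
  qed
  ultimately show ?thesis
    by (intro exI[of _ N] exI[of _ K] exI[of _ v]) (auto simp: K_def)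
qed

end
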